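(* Let $\lambda_1>0$, $\lambda_0\ge 0$ and $0<\sum_{i=1}^n y_i<n$, where $\boldsymbol y=(y_1,\dots,y_n)^T$ with $y_i\in\{0,1\}$ is the vector of observed binary responses. Let $$M_{pen}(\boldsymbol\beta)=-L_n(\boldsymbol\beta)+\lambda_1\sum_{j=1}^J\|\boldsymbol\beta_j\|_{\boldsymbol K_j}+\lambda_0\sum_{j=1}^J\sum_{0\le r<s\le p_j}w_0^{(j,rs)}\|\beta_{j,r}-\beta_{j,s}\|_0,\qquad \boldsymbol\beta\in\mathbb R^{p+1}.$$ Then the set $$S:=\Big\{\hat{\boldsymbol\beta}\ \Big|\ \hat{\boldsymbol\beta}=\operatorname*{arg\,min}_{\boldsymbol\beta}M_{pen}(\boldsymbol\beta)\Big\}$$ of minimizers of $M_{pen}$ is nonempty. Moreover, the value of the objective function $M_{pen}(\cdot)$ decreases if coefficients that are close enough to each other are fused, i.e.: for every factor $j$, every pair of levels $1\le r<s\le p_j$ and every $\boldsymbol\beta^{f}\in\mathbb R^{p+1}$ with $\beta^{f}_{j,r}=\beta^{f}_{j,s}$ there is $\delta>0$ such that for every $\boldsymbol\beta^{nf}\in\mathbb R^{p+1}$ which agrees with $\boldsymbol\beta^{f}$ in all coordinates except those of levels $r$ and $s$ of factor $j$, and which satisfies $0<|\beta^{nf}_{j,r}-\beta^{nf}_{j,s}|<\delta$ and $\beta^{f}_{j,r}=\beta^{f}_{j,s}\in[\min\{\beta^{nf}_{j,r},\beta^{nf}_{j,s}\},\max\{\beta^{nf}_{j,r},\beta^{nf}_{j,s}\}]$,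 one has $M_{pen}(\boldsymbol\beta^{f})<M_{pen}(\boldsymbol\beta^{nf})$.
   Context: Setting: there are $J\in\mathbb N$ categorical covariates (factors) observed on a sample of size $n$; factor $j$ has $p_j+1$ levels $0,1,\dots,p_j$, level $0$ being the reference category, and $p=\sum_{j=1}^J p_j$ is fixed (both $p\le n$ and $p>n$ are allowed). The parameter vector is $\boldsymbol\beta=(\beta_0,\boldsymbol\beta_1,\dots,\boldsymbol\beta_J)\in\mathbb R^{p+1}$ with intercept $\beta_0$ and $\boldsymbol\beta_j=(\beta_{j,1},\dots,\beta_{j,p_j})\in\mathbb R^{p_j}$; by convention $\beta_{j,0}=0$. The $i$-th row of the fixed design matrix is $\boldsymbol x_i=(1,\boldsymbol x_{i,1},\dots,\boldsymbol x_{i,J})\in\mathbb R^{p+1}$, where $\boldsymbol x_{i,j}\in\{0,1\}^{p_j}$ is the dummy coding of factor $j$: its $k$-th entry is $1$ if and only if factor $j$ takes level $k$ in observation $i$ (all entries are $0$ for the reference level). The model is logistic regression, $\mathbb E(Y\mid \boldsymbol X=\boldsymbol x)=\exp(\boldsymbol x\boldsymbol\beta)/(1+\exp(\boldsymbol x\boldsymbol\beta))$, with log likelihood $L_n(\boldsymbol\beta)=\sum_{i=1}^n\{y_i\boldsymbol x_i\boldsymbol\beta-\ln(1+\exp(\boldsymbol x_i\boldsymbol\beta))\}$. For a symmetric positive definite matrix $\boldsymbol K$, $\|\boldsymbol\xi\|_{\boldsymbol K}=(\boldsymbol\xi^T\boldsymbol K\boldsymbol\xi)^{1/2}$; $\boldsymbol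 K_j\in\mathbb R^{p_j\times p_j}$ are given symmetric positive definite matrices. For $t\in\mathbb R$, $\|t\|_0=0$ if $t=0$ and $\|t\|_0=1$ if $t\neq0$. The $w_0^{(j,rs)}>0$ are given weights.
   Formalization: The fusion claim (strict decrease of the objective when close coefficients are fused) is stated only for λ_0>0, because it is false for λ_0=0; nonemptiness of the set of minimizers is stated for all λ_0≥0. *)

theory Defs
  imports "HOL-Analysis.Analysis" "Jordan_Normal_Form.Matrix"
begin

unbundle no vec_syntax
no_notation inner (infix "\<bullet>" 70)
hide_type (open) Finite_Cartesian_Product.vec
hide_const (open) Finite_Cartesian_Product.vec Finite_Cartesian_Product.row Finite_Cartesian_Product.mat

text \<open>
  Factors are numbered \<open>1, \<dots>, J\<close>, and factor \<open>j\<close> has the levels \<open>0, \<dots>, p j\<close>. A parameter vector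
  \<open>(\<beta>\<^sub>0, \<beta>\<^sub>1, \<dots>, \<beta>\<^sub>J)\<close> is a vector with \<open>1 + (p 1 + \<dots> + p J)\<close> coordinates: coordinate \<open>0\<close> is the
  intercept, and it is followed by the blocks of the factors in their order.
\<close>

definition nparams :: "nat \<Rightarrow> (nat \<Rightarrow> nat) \<Rightarrow> nat" where
  "nparams J p = (\<Sum>j=1..J. p j)"

text \<open>The position of level \<open>k\<close> of factor \<open>j\<close>; meaningful for \<open>1 \<le> k \<le> p j\<close> only.\<close>

definition coord :: "(nat \<Rightarrow> nat) \<Rightarrow> nat \<Rightarrow> nat \<Rightarrow> nat" where
  "coord p j k = (\<Sum>i=1..<j. p i) + k"

definition coef :: "(nat \<Rightarrow> nat) \<Rightarrow> real vec \<Rightarrow> nat \<Rightarrow> nat \<Rightarrow> real" where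
  "coef p b j k = (if k = 0 then 0 else b $ coord p j k)"

text \<open>Vectors are indexed from \<open>0\<close>, so entry \<open>k\<close> of the block belongs to level \<open>k + 1\<close>.\<close>

definition block :: "(nat \<Rightarrow> nat) \<Rightarrow> real vec \<Rightarrow> nat \<Rightarrow> real vec" where
  "block p b j = vec (p j) (\<lambda>k. coef p b j (Suc k))"

text \<open>
  \<open>lev i j\<close> is the level of factor \<open>j\<close> in observation \<open>i\<close>; the \<open>n\<close> observations are numbered from \<open>0\<close>,
  like the rows of a matrix. The conditions determine every entry of \<open>X\<close>.
\<close>

definition dummy_design ::
  "nat \<Rightarrow> nat \<Rightarrow> (nat \<Rightarrow> nat) \<Rightarrow> (nat \<Rightarrow> nat \<Rightarrow> nat) \<Rightarrow> real mat \<Rightarrow> bool" where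
  "dummy_design n J p lev X \<longleftrightarrow>
     X \<in> carrier_mat n (nparams J p + 1) \<and>
     (\<forall>i<n. X $$ (i, 0) = 1 \<and>
       (\<forall>j\<in>{1..J}. lev i j \<le> p j \<and>
         (\<forall>k\<in>{1..p j}. X $$ (i, coord p j k) = (if lev i j = k then 1 else 0))))"

definition loglik :: "real mat \<Rightarrow> real vec \<Rightarrow> real vec \<Rightarrow> real" where
  "loglik X y b =
     (\<Sum>i<dim_row X. y $ i * (row X i \<bullet> b) - ln (1 + exp (row X i \<bullet> b)))"

definition sym_pos_def :: "nat \<Rightarrow> real mat \<Rightarrow> bool" where
  "sym_pos_def m K \<longleftrightarrow>
     K \<in> carrier_mat m m \<and> transpose_mat K = K \<and>
     (\<forall>v\<in>carrier_vec m. v \<noteq> 0\<^sub>v m \<longrightarrow> 0 < v \<bullet> (K *\<^sub>v v))"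

definition knorm :: "real mat \<Rightarrow> real vec \<Rightarrow> real" where
  "knorm K v = sqrt (v \<bullet> (K *\<^sub>v v))"

definition l0 :: "real \<Rightarrow> real" where
  "l0 t = (if t = 0 then 0 else 1)"

definition Mpen ::
  "nat \<Rightarrow> (nat \<Rightarrow> nat) \<Rightarrow> real mat \<Rightarrow> real vec \<Rightarrow> (nat \<Rightarrow> real mat) \<Rightarrow> (nat \<Rightarrow> nat \<Rightarrow> nat \<Rightarrow> real)
    \<Rightarrow> real \<Rightarrow> real \<Rightarrow> real vec \<Rightarrow> real" where
  "Mpen J p X y K w lam1 lam0 b =
     - loglik X y b
     + lam1 * (\<Sum>j=1..J. knorm (K j) (block p b j))
     + lam0 * (\<Sum>j=1..J. \<Sum>s\<le>p j. \<Sum>r<s. w j r s * l0 (coef p b j r - coef p b j s))"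

end

theory Submission
  imports Defs "Jordan_Normal_Form.Determinant"
begin

text \<open>
  The objective splits into a part that is continuous in \<open>\<beta>\<close>, the negative log likelihood plus the
  \<open>K\<close>-norms (\<open>continuous_part\<close>, \<open>continuous_part_tendsto\<close>), and \<open>\<lambda>\<^sub>0\<close> times a weighted count of the
  pairs of distinct coefficients (\<open>fusion_part\<close>). Coefficients that differ still differ after a small
  change of \<open>\<beta>\<close>; so near any given point the count can only jump upwards (\<open>eventually_l0_pairs_le\<close>).
  Both claims rest on this.

  Existence. The objective is lower semicontinuous, so it attains a minimum on every box
  (\<open>lsc_attains_min_on_compact\<close>), and it remains to see that a sublevel set lies in a box. As
  \<open>\<lambda>\<^sub>1 > 0\<close> and a positive definite form dominates every coordinate
  (\<open>sym_pos_def_coordinate_bound\<close>), the penalty bounds all level coefficients. It does not see the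
  intercept; here the likelihood helps: a success with a very negative linear predictor, or a failure
  with a very positive one, is costly, and the condition on \<open>\<Sum> y\<^sub>i\<close> provides one success and one
  failure (\<open>intercept_bounded\<close>).

  Fusion. At \<open>\<beta>\<^sup>f\<close> the pair \<open>(r, s)\<close> costs nothing, at \<open>\<beta>\<^sup>n\<^sup>f\<close> it costs \<open>\<lambda>\<^sub>0 w\<close>. Close to
  \<open>\<beta>\<^sup>f\<close> no other pair gets cheaper (\<open>fusion_part_gap\<close>), while the continuous part loses less than
  \<open>\<lambda>\<^sub>0 w\<close>. Since the fused value lies between the two separate ones, a small gap between these does
  force \<open>\<beta>\<^sup>n\<^sup>f\<close> to be close to \<open>\<beta>\<^sup>f\<close>.

  Limits are taken for functions \<open>z :: nat \<Rightarrow> real\<close>, in the topology of pointwise convergence, and the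
  objective is evaluated at \<open>vec N z\<close>; in this form Tychonoff's theorem makes the boxes compact.
\<close>

section \<open>Lower semicontinuous functions\<close>

text \<open>
  If no point were a minimizer, every \<open>x\<close> would have a better point \<open>g x\<close>, and the open sets where
  \<open>f\<close> exceeds \<open>f (g x)\<close> would cover \<open>C\<close>. The best of the finitely many \<open>g x\<close> of a finite subcover
  lies in one of these sets, so another of them is still better.
\<close>

lemma lsc_attains_min_on_compact:
  fixes f :: "'a::topological_space \<Rightarrow> real"
  assumes C: "compact C" "C \<noteq> {}"
    and lsc: "\<And>x c. x \<in> C \<Longrightarrow> c < f x \<Longrightarrow> eventually (\<lambda>z. c < f z) (nhds x)"
  shows "\<exists>x\<in>C. \<forall>y\<in>C. f x \<le> f y"
proof (rule ccontr)
  assume "\<not> ?thesis"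
  then have "\<forall>x\<in>C. \<exists>y. y \<in> C \<and> f y < f x"
    by (auto simp: not_le)
  then obtain g where g: "\<And>x. x \<in> C \<Longrightarrow> g x \<in> C" "\<And>x. x \<in> C \<Longrightarrow> f (g x) < f x"
    by metis
  have "\<exists>U. open U \<and> x \<in> U \<and> (\<forall>z\<in>U. f (g x) < f z)" if "x \<in> C" for x
    using lsc[OF that g(2)[OF that]] by (simp add: eventually_nhds)
  then obtain U where U: "\<And>x. x \<in> C \<Longrightarrow> open (U x)" "\<And>x. x \<in> C \<Longrightarrow> x \<in> U x"
    "\<And>x z. x \<in> C \<Longrightarrow> z \<in> U x \<Longrightarrow> f (g x) < f z"
    by metis
  obtain D where D: "D \<subseteq> C" "finite D" "C \<subseteq> (\<Union>x\<in>D. U x)"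
    using compactE_image[OF C(1), of C U] U(1,2) by blast
  then have "D \<noteq> {}"
    using C(2) by auto
  then obtain d where d: "d \<in> D" "\<And>x. x \<in> D \<Longrightarrow> f (g d) \<le> f (g x)"
    using D(2) ex_min_if_finite[of "(\<lambda>x. f (g x)) ` D"] by (auto simp: not_less)
  obtain x where "x \<in> D" "g d \<in> U x"
    using g(1) d(1) D by blast
  then have "f (g x) < f (g d)"
    using U(3) D(1) by blast
  with d(2)[OF \<open>x \<in> D\<close>] show False
    by simp
qed

lemma continuous_plus_locally_minimal_lsc:
  fixes f h :: "'a::topological_space \<Rightarrow> real"
  assumes f: "(f \<longlongrightarrow> f x) (nhds x)"
    and h: "eventually (\<lambda>z. h x \<le> h z) (nhds x)"
    and c: "c < f x + h x"
  shows "eventually (\<lambda>z. c < f z + h z) (nhds x)"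
proof -
  have "eventually (\<lambda>z. c - h x < f z) (nhds x)"
    using f c by (intro order_tendstoD(1)) auto
  with h show ?thesis
    by eventually_elim linarith
qed

lemma compact_box:
  fixes R :: real
  shows "compact {z :: 'i \<Rightarrow> real. \<forall>i. \<bar>z i\<bar> \<le> R}"
proof -
  have "{z :: 'i \<Rightarrow> real. \<forall>i. \<bar>z i\<bar> \<le> R} = PiE UNIV (\<lambda>_. {-R..R})"
    by (auto simp: PiE_def abs_le_iff Pi_def) (metis minus_le_iff)+
  moreover have "compactin (product_topology (\<lambda>_. euclidean) UNIV)
      (PiE (UNIV :: 'i set) (\<lambda>_. {-R..R}))"
    by (simp add: compactin_PiE)
  ultimately show ?thesis
    by (simp add: euclidean_product_topology flip: compactin_euclidean_iff)
qed

text \<open>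
  Uniformly close functions are pointwise close, so a neighbourhood in the product topology contains
  a uniform box, even for infinitely many coordinates.
\<close>

lemma eventually_nhds_fun_imp_box:
  fixes x :: "'i \<Rightarrow> real"
  assumes "eventually P (nhds x)"
  shows "\<exists>\<delta>>0. \<forall>z. (\<forall>i. \<bar>z i - x i\<bar> < \<delta>) \<longrightarrow> P z"
proof (rule ccontr)
  assume "\<not> ?thesis"
  then have "\<forall>n. \<exists>z. (\<forall>i. \<bar>z i - x i\<bar> < inverse (real (Suc n))) \<and> \<not> P z"
    by (metis inverse_positive_iff_positive of_nat_0_less_iff zero_less_Suc)
  then obtain z where z: "\<And>n i. \<bar>z n i - x i\<bar> < inverse (real (Suc n))" "\<And>n. \<not> P (z n)"
    by metis
  have "(\<lambda>n. z n i) \<longlonglongrightarrow> x i" for i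
    by (rule Lim_null[THEN iffD2], rule Lim_null_comparison[OF _ LIMSEQ_inverse_real_of_nat])
      (use z(1) in \<open>auto intro!: always_eventually less_imp_le\<close>)
  then have "limitin (product_topology (\<lambda>_. euclidean) UNIV) z x sequentially"
    by (simp add: limitin_componentwise)
  then have "z \<longlonglongrightarrow> x"
    by (simp add: euclidean_product_topology)
  then have "eventually (\<lambda>n. P (z n)) sequentially"
    by (rule eventually_compose_filterlim[OF assms])
  then show False
    using z(2) by auto
qed

section \<open>Positive definite forms\<close>

lemma sym_pos_def_solvable:
  assumes "sym_pos_def m K" and c: "c \<in> carrier_vec m"
  shows "\<exists>u\<in>carrier_vec m. K *\<^sub>v u = c"
proof -
  have K: "K \<in> carrier_mat m m" and pos: "\<And>v. v \<in> carrier_vec m \<Longrightarrow> v \<noteq> 0\<^sub>v m \<Longrightarrow> 0 < v \<bullet> (K *\<^sub>v v)"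
    using assms(1) by (auto simp: sym_pos_def_def)
  have "det K \<noteq> 0"
    unfolding det_0_iff_vec_prod_zero_field[OF K] using pos by fastforce
  then obtain B where B: "B \<in> carrier_mat m m" "K * B = 1\<^sub>m m"
    using det_non_zero_imp_unit[OF K, of "()"] by (auto simp: Units_def ring_mat_def)
  then have "K *\<^sub>v (B *\<^sub>v c) = c"
    using K c by (simp flip: assoc_mult_mat_vec)
  then show ?thesis
    using B c by (intro bexI[of _ "B *\<^sub>v c"]) auto
qed

lemma sym_pos_def_nonneg:
  assumes "sym_pos_def m K" "v \<in> carrier_vec m"
  shows "0 \<le> v \<bullet> (K *\<^sub>v v)"
  using assms by (cases "v = 0\<^sub>v m") (auto simp: sym_pos_def_def less_imp_le)

text \<open>
  This is the Cauchy--Schwarz inequality of the form: with \<open>K u = e\<^sub>i\<close> the coordinate \<open>v\<^sub>i\<close> is the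
  \<open>K\<close>-inner product of \<open>u\<close> and \<open>v\<close>. The constant is \<open>\<parallel>u\<parallel>\<^sub>K = sqrt (u\<^sub>i)\<close>.
\<close>

lemma sym_pos_def_coordinate_bound:
  assumes K: "sym_pos_def m K" and i: "i < m"
  shows "\<exists>C. \<forall>v\<in>carrier_vec m. \<bar>v $ i\<bar> \<le> C * knorm K v"
proof -
  have Kc: "K \<in> carrier_mat m m" and sym: "transpose_mat K = K"
    using K by (auto simp: sym_pos_def_def)
  obtain u where u: "u \<in> carrier_vec m" "K *\<^sub>v u = unit_vec m i"
    using sym_pos_def_solvable[OF K, of "unit_vec m i"] by auto
  have "u \<noteq> 0\<^sub>v m"
  proof
    assume "u = 0\<^sub>v m"
    moreover have "K *\<^sub>v 0\<^sub>v m = 0\<^sub>v m"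
      using Kc by (intro eq_vecI) auto
    ultimately have "unit_vec m i = (0\<^sub>v m :: real vec)"
      using u by simp
    then have "unit_vec m i $ i = (0\<^sub>v m :: real vec) $ i"
      by simp
    then show False
      using i by simp
  qed
  then have "0 < u \<bullet> (K *\<^sub>v u)"
    using K u(1) by (auto simp: sym_pos_def_def)
  then have ui: "0 < u $ i"
    using u i by simp
  have "\<bar>v $ i\<bar> \<le> sqrt (u $ i) * knorm K v" if v: "v \<in> carrier_vec m" for v
  proof -
    \<comment> \<open>The choice of \<open>t\<close> that minimizes the form at \<open>v - t u\<close>.\<close>
    define t where "t = v $ i / u $ i"
    have Kv: "K *\<^sub>v v \<in> carrier_vec m"
      using Kc v by auto
    have uKv: "u \<bullet> (K *\<^sub>v v) = v $ i"
      using transpose_vec_mult_scalar[OF Kc v u(1)] u v i sym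
      by (simp add: comm_scalar_prod[OF u(1) Kv] comm_scalar_prod[of _ m])
    have "0 \<le> (v - t \<cdot>\<^sub>v u) \<bullet> (K *\<^sub>v (v - t \<cdot>\<^sub>v u))"
      using K v u by (intro sym_pos_def_nonneg) auto
    also have "K *\<^sub>v (v - t \<cdot>\<^sub>v u) = K *\<^sub>v v - t \<cdot>\<^sub>v unit_vec m i"
      using Kc v u by (simp add: mult_minus_distrib_mat_vec mult_mat_vec)
    also have "(v - t \<cdot>\<^sub>v u) \<bullet> (K *\<^sub>v v - t \<cdot>\<^sub>v unit_vec m i)
        = v \<bullet> (K *\<^sub>v v) - t * v $ i - t * v $ i + t * t * u $ i"
      using v u Kv i uKv
      by (simp add: minus_scalar_prod_distrib[of _ m] scalar_prod_minus_distrib[of _ m] algebra_simps)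
    also have "\<dots> = v \<bullet> (K *\<^sub>v v) - (v $ i)\<^sup>2 / u $ i"
      using ui by (simp add: t_def field_simps power2_eq_square)
    finally have "(v $ i)\<^sup>2 \<le> u $ i * (v \<bullet> (K *\<^sub>v v))"
      using ui by (simp add: field_simps)
    then show ?thesis
      unfolding knorm_def real_sqrt_mult[symmetric] by (rule real_le_rsqrt[of "\<bar>_\<bar>", simplified])
  qed
  then show ?thesis
    by blast
qed

section \<open>The logistic loss\<close>

lemma neg_loglik_eq: "- loglik X y b = (\<Sum>i<dim_row X. ln (1 + exp (row X i \<bullet> b)) - y $ i * (row X i \<bullet> b))"
  by (simp add: loglik_def flip: sum_negf)

lemma ln_one_plus_exp_ge:
  fixes t :: real
  shows "0 \<le> ln (1 + exp t)" "t \<le> ln (1 + exp t)"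
proof -
  show "0 \<le> ln (1 + exp t)" by simp
  have "ln (exp t) \<le> ln (1 + exp t)"
    by (subst ln_le_cancel_iff) (auto simp: add_pos_pos)
  then show "t \<le> ln (1 + exp t)" by simp
qed

text \<open>
  With binary responses every observation contributes a nonnegative loss, so the loss of a single
  observation is controlled by the total.
\<close>

lemma logistic_loss_le_neg_loglik:
  assumes "dim_row X = n" and y: "\<And>i. i < n \<Longrightarrow> y $ i \<in> {0, 1}" and i: "i < n"
  shows "ln (1 + exp (row X i \<bullet> b)) - y $ i * (row X i \<bullet> b) \<le> - loglik X y b"
  unfolding neg_loglik_eq assms(1)
proof (rule member_le_sum)
  fix k assume "k \<in> {..<n} - {i}"
  then show "0 \<le> ln (1 + exp (row X k \<bullet> b)) - y $ k * (row X k \<bullet> b)"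
    using y[of k] ln_one_plus_exp_ge[of "row X k \<bullet> b"] by auto
qed (use i in auto)

section \<open>The penalised objective\<close>

definition continuous_part where
  "continuous_part J p X y K lam1 b =
     - loglik X y b + lam1 * (\<Sum>j=1..J. knorm (K j) (block p b j))"

text \<open>
  The larger level \<open>s\<close> comes second in the triple \<open>(j, s, r)\<close>, as the range of \<open>r\<close> depends on it.
\<close>

definition level_pairs :: "nat \<Rightarrow> (nat \<Rightarrow> nat) \<Rightarrow> (nat \<times> nat \<times> nat) set" where
  "level_pairs J p = (SIGMA j:{1..J}. SIGMA s:{..p j}. {..<s})"

definition fusion_part where
  "fusion_part J p w b =
     (\<Sum>(j, s, r)\<in>level_pairs J p. w j r s * l0 (coef p b j r - coef p b j s))"

lemma finite_level_pairs [simp]: "finite (level_pairs J p)"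
  by (simp add: level_pairs_def)

lemma Mpen_eq:
  "Mpen J p X y K w lam1 lam0 b = continuous_part J p X y K lam1 b + lam0 * fusion_part J p w b"
  by (simp add: Mpen_def continuous_part_def fusion_part_def level_pairs_def sum.Sigma split_def)

lemma coord_le_nparams:
  assumes "j \<in> {1..J}" "k \<le> p j"
  shows "coord p j k \<le> nparams J p"
proof -
  have "(\<Sum>i=1..<j. p i) + k \<le> (\<Sum>i=1..<j. p i) + p j"
    using assms by simp
  also have "\<dots> = sum p {1..<Suc j}"
    using assms by simp
  also have "\<dots> \<le> sum p {1..J}"
    using assms by (intro sum_mono2) auto
  finally show ?thesis
    by (simp add: coord_def nparams_def)
qed

lemma coord_surj:
  assumes "m \<in> {1..nparams J p}"
  shows "\<exists>j\<in>{1..J}. \<exists>k\<in>{1..p j}. coord p j k = m"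
  using assms
proof (induction J)
  case 0
  then show ?case by (simp add: nparams_def)
next
  case (Suc J)
  show ?case
  proof (cases "m \<le> nparams J p")
    case True
    with Suc obtain j k where "j \<in> {1..J}" "k \<in> {1..p j}" "coord p j k = m"
      by auto
    then show ?thesis
      by (intro bexI[of _ j] bexI[of _ k]) auto
  next
    case False
    then have "coord p (Suc J) (m - nparams J p) = m"
      by (simp add: coord_def nparams_def atLeastLessThanSuc_atLeastAtMost)
    then show ?thesis
      using False Suc.prems
      by (intro bexI[of _ "Suc J"] bexI[of _ "m - nparams J p"]) (auto simp: nparams_def)
  qed
qed

lemma coef_vec:
  assumes "j \<in> {1..J}" "k \<le> p j"
  shows "coef p (vec (nparams J p + 1) z) j k = (if k = 0 then 0 else z (coord p j k))"
  using coord_le_nparams[where p = p, OF assms] by (simp add: coef_def)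

lemma tendsto_coordinate: "((\<lambda>z :: 'i \<Rightarrow> real. z i) \<longlongrightarrow> x i) (nhds x)"
proof -
  have "continuous_on UNIV (\<lambda>z :: 'i \<Rightarrow> real. z i)"
    by simp
  then show ?thesis
    by (intro tendsto_at_iff_tendsto_nhds[THEN iffD1]) (simp add: continuous_on_def)
qed

lemma tendsto_coef:
  assumes "j \<in> {1..J}" "k \<le> p j"
  shows "((\<lambda>z. coef p (vec (nparams J p + 1) z) j k)
           \<longlongrightarrow> coef p (vec (nparams J p + 1) x) j k) (nhds x)"
  unfolding coef_vec[where J = J and p = p, OF assms] by (auto intro: tendsto_coordinate)

lemma continuous_part_tendsto:
  assumes X: "X \<in> carrier_mat n (nparams J p + 1)"
    and K: "\<And>j. j \<in> {1..J} \<Longrightarrow> K j \<in> carrier_mat (p j) (p j)"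
  shows "((\<lambda>z. continuous_part J p X y K lam1 (vec (nparams J p + 1) z))
           \<longlongrightarrow> continuous_part J p X y K lam1 (vec (nparams J p + 1) x)) (nhds x)"
proof -
  have lin: "((\<lambda>z. row X i \<bullet> vec (nparams J p + 1) z) \<longlongrightarrow> row X i \<bullet> vec (nparams J p + 1) x) (nhds x)"
    for i
    by (auto simp: scalar_prod_def intro!: tendsto_add tendsto_sum tendsto_mult tendsto_const tendsto_coordinate)
  have pen: "((\<lambda>z. knorm (K j) (block p (vec (nparams J p + 1) z) j))
      \<longlongrightarrow> knorm (K j) (block p (vec (nparams J p + 1) x) j)) (nhds x)" if j: "j \<in> {1..J}" for j
  proof -
    have "knorm (K j) (block p b j) = sqrt (\<Sum>i<p j. coef p b j (Suc i) *
        (\<Sum>k<p j. K j $$ (i, k) * coef p b j (Suc k)))" for b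
      using K[OF j] by (simp add: knorm_def block_def scalar_prod_def atLeast0LessThan)
    then show ?thesis
      using j by (auto intro!: tendsto_real_sqrt tendsto_sum tendsto_mult tendsto_const tendsto_coef[simplified])
  qed
  have "1 + exp t \<noteq> 0" for t :: real
    using exp_gt_zero[of t] by linarith
  then have "((\<lambda>z. - loglik X y (vec (nparams J p + 1) z))
      \<longlongrightarrow> - loglik X y (vec (nparams J p + 1) x)) (nhds x)"
    unfolding neg_loglik_eq
    by (intro tendsto_sum tendsto_diff tendsto_ln tendsto_add tendsto_exp tendsto_mult tendsto_const lin)
  then show ?thesis
    unfolding continuous_part_def by (intro tendsto_add tendsto_mult tendsto_sum tendsto_const pen)
qed

lemma l0_locally_minimal:
  assumes "(f \<longlongrightarrow> f x) (nhds x)"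
  shows "eventually (\<lambda>z. l0 (f x) \<le> l0 (f z)) (nhds x)"
proof (cases "f x = 0")
  case True
  then show ?thesis by (simp add: l0_def)
next
  case False
  with assms have "eventually (\<lambda>z. f z \<noteq> 0) (nhds x)"
    by (rule tendsto_imp_eventually_ne)
  then show ?thesis
    by eventually_elim (simp add: l0_def)
qed

text \<open>
  A nonzero difference stays nonzero nearby and a zero difference can only become nonzero;
  there are finitely many pairs, so one neighbourhood serves them all.
\<close>

lemma eventually_l0_pairs_le:
  "eventually (\<lambda>z. \<forall>(j, s, r)\<in>level_pairs J p.
       l0 (coef p (vec (nparams J p + 1) x) j r - coef p (vec (nparams J p + 1) x) j s)
     \<le> l0 (coef p (vec (nparams J p + 1) z) j r - coef p (vec (nparams J p + 1) z) j s)) (nhds x)"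
  by (intro eventually_ball_finite ballI)
    (auto simp: level_pairs_def intro!: l0_locally_minimal tendsto_diff tendsto_coef[simplified])

lemma fusion_part_mono:
  assumes w: "\<And>j s r. (j, s, r) \<in> level_pairs J p \<Longrightarrow> 0 \<le> w j r s"
    and le: "\<forall>(j, s, r)\<in>level_pairs J p.
       l0 (coef p b j r - coef p b j s) \<le> l0 (coef p b' j r - coef p b' j s)"
  shows "fusion_part J p w b \<le> fusion_part J p w b'"
  unfolding fusion_part_def using w le by (auto intro!: sum_mono mult_left_mono)

lemma fusion_part_gap:
  assumes w: "\<And>j s r. (j, s, r) \<in> level_pairs J p \<Longrightarrow> 0 \<le> w j r s"
    and le: "\<forall>(j, s, r)\<in>level_pairs J p.
       l0 (coef p b j r - coef p b j s) \<le> l0 (coef p b' j r - coef p b' j s)"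
    and P: "(j, s, r) \<in> level_pairs J p"
    and eq: "coef p b j r = coef p b j s" and ne: "coef p b' j r \<noteq> coef p b' j s"
  shows "fusion_part J p w b + w j r s \<le> fusion_part J p w b'"
proof -
  define d where "d = (\<lambda>(j, s, r). w j r s * l0 (coef p b' j r - coef p b' j s)
      - w j r s * l0 (coef p b j r - coef p b j s))"
  have "d (j, s, r) \<le> sum d (level_pairs J p)"
  proof (rule member_le_sum[OF P])
    fix q assume "q \<in> level_pairs J p - {(j, s, r)}"
    moreover obtain j' s' r' where "q = (j', s', r')"
      by (cases q)
    ultimately show "0 \<le> d q"
      using w[of j' s' r'] bspec[OF le, of q] by (simp add: d_def mult_left_mono)
  qed simp
  moreover have "d (j, s, r) = w j r s"
    using eq ne by (simp add: d_def l0_def)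
  moreover have "sum d (level_pairs J p) = fusion_part J p w b' - fusion_part J p w b"
    by (simp add: d_def fusion_part_def split_def sum_subtractf)
  ultimately show ?thesis
    by simp
qed

lemma fusion_part_nonneg:
  assumes "\<And>j s r. (j, s, r) \<in> level_pairs J p \<Longrightarrow> 0 \<le> w j r s"
  shows "0 \<le> fusion_part J p w b"
  unfolding fusion_part_def using assms by (auto intro!: sum_nonneg simp: l0_def)

section \<open>Bounded sublevel sets\<close>

lemma finite_uniform_bound:
  fixes f :: "'a \<Rightarrow> 'b \<Rightarrow> real"
  assumes "finite A" "\<And>a. a \<in> A \<Longrightarrow> \<exists>R. \<forall>b. Q b \<longrightarrow> f a b \<le> R"
  shows "\<exists>R. \<forall>a\<in>A. \<forall>b. Q b \<longrightarrow> f a b \<le> R"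
proof -
  obtain R where R: "\<And>a b. a \<in> A \<Longrightarrow> Q b \<Longrightarrow> f a b \<le> R a"
    using assms(2) by metis
  have "f a b \<le> Max (R ` A)" if "a \<in> A" "Q b" for a b
    using R[OF that] assms(1) that(1) by (auto intro: order.trans Max_ge)
  then show ?thesis
    by blast
qed

text \<open>
  The likelihood contributes nonnegatively, so a bound \<open>c\<close> on the objective gives the bound
  \<open>c / \<lambda>\<^sub>1\<close> on each \<open>K\<close>-norm and hence bounds each coordinate of each block.
\<close>

lemma level_coefficients_bounded:
  assumes X: "dim_row X = n"
    and y: "\<And>i. i < n \<Longrightarrow> y $ i \<in> {0, 1}"
    and K: "\<And>j. j \<in> {1..J} \<Longrightarrow> sym_pos_def (p j) (K j)"
    and lam1: "0 < lam1"
    and m: "m \<in> {1..nparams J p}"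
  shows "\<exists>R. \<forall>b. continuous_part J p X y K lam1 b \<le> c \<longrightarrow> \<bar>b $ m\<bar> \<le> R"
proof -
  obtain j k where j: "j \<in> {1..J}" and k: "k \<in> {1..p j}" and m: "coord p j k = m"
    using coord_surj[OF m] by blast
  have k': "k - 1 < p j"
    using k by auto
  obtain C where C: "\<And>v. v \<in> carrier_vec (p j) \<Longrightarrow> \<bar>v $ (k - 1)\<bar> \<le> C * knorm (K j) v"
    using sym_pos_def_coordinate_bound[OF K[OF j] k'] by blast
  have "\<bar>b $ m\<bar> \<le> \<bar>C\<bar> * (c / lam1)" if "continuous_part J p X y K lam1 b \<le> c" for b
  proof -
    have nn: "0 \<le> knorm (K i) (block p b i)" if "i \<in> {1..J}" for i
      using sym_pos_def_nonneg[OF K[OF that], of "block p b i"] by (simp add: knorm_def block_def)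
    have "0 \<le> - loglik X y b"
      unfolding neg_loglik_eq X
    proof (rule sum_nonneg)
      fix i assume "i \<in> {..<n}"
      then show "0 \<le> ln (1 + exp (row X i \<bullet> b)) - y $ i * (row X i \<bullet> b)"
        using y[of i] ln_one_plus_exp_ge[of "row X i \<bullet> b"] by auto
    qed
    then have "lam1 * (\<Sum>j=1..J. knorm (K j) (block p b j)) \<le> c"
      using that by (simp add: continuous_part_def)
    moreover have "lam1 * knorm (K j) (block p b j) \<le> lam1 * (\<Sum>j=1..J. knorm (K j) (block p b j))"
      using lam1 nn j by (intro mult_left_mono member_le_sum) auto
    ultimately have "lam1 * knorm (K j) (block p b j) \<le> c"
      by linarith
    then have le: "knorm (K j) (block p b j) \<le> c / lam1"
      using lam1 by (simp add: pos_le_divide_eq mult.commute)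
    have "b $ m = block p b j $ (k - 1)"
      using k k' m by (simp add: block_def coef_def)
    then have "\<bar>b $ m\<bar> \<le> C * knorm (K j) (block p b j)"
      using C[of "block p b j"] by (simp add: block_def)
    also have "\<dots> \<le> \<bar>C\<bar> * knorm (K j) (block p b j)"
      using nn[OF j] by (intro mult_right_mono) auto
    also have "\<dots> \<le> \<bar>C\<bar> * (c / lam1)"
      using le by (intro mult_left_mono) auto
    finally show ?thesis .
  qed
  then show ?thesis
    by blast
qed

lemma continuous_part_ge_neg_loglik:
  assumes "\<And>j. j \<in> {1..J} \<Longrightarrow> sym_pos_def (p j) (K j)" "0 < lam1"
  shows "- loglik X y b \<le> continuous_part J p X y K lam1 b"
proof -
  have "0 \<le> (\<Sum>j=1..J. knorm (K j) (block p b j))"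
    using sym_pos_def_nonneg[OF assms(1)] by (intro sum_nonneg) (simp add: knorm_def block_def)
  then show ?thesis
    using assms(2) by (simp add: continuous_part_def)
qed

text \<open>
  Once the level coefficients are bounded, every linear predictor is the intercept up to a bounded
  error. A success bounds its predictor from below and a failure bounds its predictor from above,
  because the logistic losses are at least \<open>- t\<close> and \<open>t\<close>, respectively.
\<close>

lemma intercept_bounded:
  assumes X: "X \<in> carrier_mat n (N + 1)" and X0: "\<And>i. i < n \<Longrightarrow> X $$ (i, 0) = 1"
    and y: "\<And>i. i < n \<Longrightarrow> y $ i \<in> {0, 1}"
    and pos: "0 < (\<Sum>i<n. y $ i)" and less: "(\<Sum>i<n. y $ i) < real n"
  shows "\<exists>R. \<forall>b. b \<in> carrier_vec (N + 1) \<and> - loglik X y b \<le> c \<and> (\<forall>m\<in>{1..N}. \<bar>b $ m\<bar> \<le> B)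
    \<longrightarrow> \<bar>b $ 0\<bar> \<le> R"
proof -
  obtain i1 where i1: "i1 < n" "y $ i1 = 1"
    using pos y sum.neutral[of "{..<n}" "\<lambda>i. y $ i"] by fastforce
  obtain i0 where i0: "i0 < n" "y $ i0 = 0"
  proof (rule ccontr)
    assume "\<not> thesis"
    then have "\<And>i. i < n \<Longrightarrow> y $ i = 1"
      using y that by fastforce
    then show False
      using less by simp
  qed
  define A where "A i = (\<Sum>m=1..N. \<bar>X $$ (i, m)\<bar> * B)" for i
  have "\<bar>b $ 0\<bar> \<le> c + \<bar>A i0\<bar> + \<bar>A i1\<bar>"
    if b: "b \<in> carrier_vec (N + 1)" and c: "- loglik X y b \<le> c" and B: "\<forall>m\<in>{1..N}. \<bar>b $ m\<bar> \<le> B" for b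
  proof -
    have split: "\<bar>row X i \<bullet> b - b $ 0\<bar> \<le> A i" if i: "i < n" for i
    proof -
      have "row X i \<bullet> b = (\<Sum>m\<in>{0..N}. X $$ (i, m) * b $ m)"
        using X b i by (auto simp: scalar_prod_def atLeastLessThanSuc_atLeastAtMost intro!: sum.cong)
      also have "\<dots> = b $ 0 + (\<Sum>m=1..N. X $$ (i, m) * b $ m)"
        using X0[OF i] by (simp add: sum.atLeast_Suc_atMost)
      finally have "\<bar>row X i \<bullet> b - b $ 0\<bar> = \<bar>\<Sum>m=1..N. X $$ (i, m) * b $ m\<bar>"
        by simp
      also have "\<dots> \<le> A i"
        unfolding A_def using B
        by (intro order.trans[OF sum_abs] sum_mono) (simp add: abs_mult mult_left_mono)
      finally show ?thesis .
    qed
    have X': "dim_row X = n"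
      using X by simp
    have "- (row X i1 \<bullet> b) \<le> c"
      using logistic_loss_le_neg_loglik[OF X' y i1(1), of b] ln_one_plus_exp_ge(1)[of "row X i1 \<bullet> b"] c
      unfolding i1(2) by linarith
    moreover have "row X i0 \<bullet> b \<le> c"
      using logistic_loss_le_neg_loglik[OF X' y i0(1), of b] ln_one_plus_exp_ge(2)[of "row X i0 \<bullet> b"] c
      unfolding i0(2) by linarith
    ultimately show ?thesis
      using split[OF i1(1)] split[OF i0(1)] by linarith
  qed
  then show ?thesis
    by blast
qed

theorem theorem3p1:
  fixes n J :: nat
    and p :: "nat \<Rightarrow> nat"
    and lev :: "nat \<Rightarrow> nat \<Rightarrow> nat"
    and X :: "real mat"
    and y :: "real vec"
    and K :: "nat \<Rightarrow> real mat"
    and w :: "nat \<Rightarrow> nat \<Rightarrow> nat \<Rightarrow> real"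
    and lam1 lam0 :: real
  assumes "dummy_design n J p lev X"
    and "y \<in> carrier_vec n"
    and "\<And>i. i < n \<Longrightarrow> y $ i \<in> {0, 1}"
    and "0 < (\<Sum>i<n. y $ i)"
    and "(\<Sum>i<n. y $ i) < real n"
    and "\<And>j. j \<in> {1..J} \<Longrightarrow> sym_pos_def (p j) (K j)"
    and "\<And>j r s. j \<in> {1..J} \<Longrightarrow> r < s \<Longrightarrow> s \<le> p j \<Longrightarrow> 0 < w j r s"
    and "0 < lam1"
    and "0 \<le> lam0"
  shows "{b. is_arg_min (Mpen J p X y K w lam1 lam0) (\<lambda>b. b \<in> carrier_vec (nparams J p + 1)) b} \<noteq> {}
    \<and> (0 < lam0 \<longrightarrow>
        (\<forall>j\<in>{1..J}. \<forall>r s. 1 \<le> r \<and> r < s \<and> s \<le> p j \<longrightarrow>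
          (\<forall>bf \<in> carrier_vec (nparams J p + 1). coef p bf j r = coef p bf j s \<longrightarrow>
            (\<exists>\<delta>>0. \<forall>bnf \<in> carrier_vec (nparams J p + 1).
              (\<forall>m < nparams J p + 1. m \<notin> {coord p j r, coord p j s} \<longrightarrow> bnf $ m = bf $ m) \<and>
              0 < \<bar>coef p bnf j r - coef p bnf j s\<bar> \<and>
              \<bar>coef p bnf j r - coef p bnf j s\<bar> < \<delta> \<and>
              coef p bf j r \<in> {min (coef p bnf j r) (coef p bnf j s) ..
                               max (coef p bnf j r) (coef p bnf j s)} \<longrightarrow>
              Mpen J p X y K w lam1 lam0 bf < Mpen J p X y K w lam1 lam0 bnf))))"
proof (intro conjI impI)
  let ?N = "nparams J p"
  let ?M = "Mpen J p X y K w lam1 lam0"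
  let ?S = "continuous_part J p X y K lam1"
  have X: "X \<in> carrier_mat n (?N + 1)" and X0: "\<And>i. i < n \<Longrightarrow> X $$ (i, 0) = 1"
    using assms(1) by (auto simp: dummy_design_def)
  have Kc: "\<And>j. j \<in> {1..J} \<Longrightarrow> K j \<in> carrier_mat (p j) (p j)"
    using assms(6) by (auto simp: sym_pos_def_def)
  have w: "\<And>j s r. (j, s, r) \<in> level_pairs J p \<Longrightarrow> 0 \<le> w j r s"
    using assms(7) by (auto simp: level_pairs_def intro!: less_imp_le)
  note cont = continuous_part_tendsto[where J = J and p = p and K = K, OF X Kc]
  have repr: "b = vec (?N + 1) (($) b)" if "b \<in> carrier_vec (?N + 1)" for b :: "real vec"
    using that by auto

  show "{b. is_arg_min ?M (\<lambda>b. b \<in> carrier_vec (?N + 1)) b} \<noteq> {}"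
  proof -
    \<comment> \<open>The box below contains the sublevel set of the value at the origin. It contains the origin
      too, which does better than every point outside the box.\<close>
    define c where "c = ?M (0\<^sub>v (?N + 1))"
    have S_le: "?S b \<le> ?M b" for b
      unfolding Mpen_eq using assms(9) fusion_part_nonneg[where J = J and p = p and w = w, OF w] by simp
    have "\<exists>B. \<forall>m\<in>{1..?N}. \<forall>b. ?S b \<le> c \<longrightarrow> \<bar>b $ m\<bar> \<le> B"
    proof (rule finite_uniform_bound)
      fix m assume m: "m \<in> {1..?N}"
      show "\<exists>R. \<forall>b. ?S b \<le> c \<longrightarrow> \<bar>b $ m\<bar> \<le> R"
        using X assms(3,6,8) m by (intro level_coefficients_bounded) auto
    qed simp
    then obtain B where B: "\<And>m b. m \<in> {1..?N} \<Longrightarrow> ?S b \<le> c \<Longrightarrow> \<bar>b $ m\<bar> \<le> B"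
      by blast
    obtain R0 where R0: "\<And>b. b \<in> carrier_vec (?N + 1) \<Longrightarrow> - loglik X y b \<le> c \<Longrightarrow>
        (\<forall>m\<in>{1..?N}. \<bar>b $ m\<bar> \<le> B) \<Longrightarrow> \<bar>b $ 0\<bar> \<le> R0"
      using intercept_bounded[OF X X0 assms(3,4,5)] by blast
    define R where "R = max 0 (max B R0)"
    have bound: "\<bar>b $ m\<bar> \<le> R" if b: "b \<in> carrier_vec (?N + 1)" and le: "?M b \<le> c" and m: "m < ?N + 1" for b m
    proof -
      have "?S b \<le> c"
        using S_le le by (rule order.trans)
      moreover have "- loglik X y b \<le> ?S b"
        using assms(6,8) by (rule continuous_part_ge_neg_loglik)
      ultimately have "\<bar>b $ 0\<bar> \<le> R0" "m \<noteq> 0 \<Longrightarrow> \<bar>b $ m\<bar> \<le> B"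
        using R0[OF b] B m by auto
      then show ?thesis
        by (cases "m = 0") (auto simp: R_def)
    qed
    have "\<exists>x\<in>{z. \<forall>i. \<bar>z i\<bar> \<le> R}. \<forall>z\<in>{z. \<forall>i. \<bar>z i\<bar> \<le> R}. ?M (vec (?N + 1) x) \<le> ?M (vec (?N + 1) z)"
    proof (rule lsc_attains_min_on_compact[OF compact_box])
      show "{z :: nat \<Rightarrow> real. \<forall>i. \<bar>z i\<bar> \<le> R} \<noteq> {}"
        by (auto simp: R_def intro!: exI[of _ "\<lambda>_. 0"])
      fix x d assume "d < ?M (vec (?N + 1) x)"
      moreover have "eventually (\<lambda>z. lam0 * fusion_part J p w (vec (?N + 1) x)
          \<le> lam0 * fusion_part J p w (vec (?N + 1) z)) (nhds x)"
        using eventually_l0_pairs_le[of J p x]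
        by eventually_elim (intro mult_left_mono fusion_part_mono w assms(9))
      ultimately show "eventually (\<lambda>z. d < ?M (vec (?N + 1) z)) (nhds x)"
        unfolding Mpen_eq by (intro continuous_plus_locally_minimal_lsc cont)
    qed
    then obtain x where x: "\<And>z. (\<And>i. \<bar>z i\<bar> \<le> R) \<Longrightarrow> ?M (vec (?N + 1) x) \<le> ?M (vec (?N + 1) z)"
      by blast
    have "?M (vec (?N + 1) x) \<le> ?M b" if b: "b \<in> carrier_vec (?N + 1)" for b
    proof (cases "?M b \<le> c")
      case True
      have "b = vec (?N + 1) (\<lambda>i. if i < ?N + 1 then b $ i else 0)"
        using b by auto
      moreover have "\<bar>if i < ?N + 1 then b $ i else 0\<bar> \<le> R" for i
        using bound[OF b True] by (simp add: R_def)
      ultimately show ?thesis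
        using x[of "\<lambda>i. if i < ?N + 1 then b $ i else 0"] by simp
    next
      case False
      have "0\<^sub>v (?N + 1) = vec (?N + 1) (\<lambda>_. 0 :: real)"
        by auto
      then have "?M (vec (?N + 1) x) \<le> c"
        using x[of "\<lambda>_. 0"] by (simp add: c_def R_def)
      with False show ?thesis
        by simp
    qed
    then have "is_arg_min ?M (\<lambda>b. b \<in> carrier_vec (?N + 1)) (vec (?N + 1) x)"
      by (auto simp: is_arg_min_def not_less)
    then show ?thesis
      by blast
  qed

  assume lam0: "0 < lam0"
  show "\<forall>j\<in>{1..J}. \<forall>r s. 1 \<le> r \<and> r < s \<and> s \<le> p j \<longrightarrow>
          (\<forall>bf \<in> carrier_vec (?N + 1). coef p bf j r = coef p bf j s \<longrightarrow>
            (\<exists>\<delta>>0. \<forall>bnf \<in> carrier_vec (?N + 1).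
              (\<forall>m < ?N + 1. m \<notin> {coord p j r, coord p j s} \<longrightarrow> bnf $ m = bf $ m) \<and>
              0 < \<bar>coef p bnf j r - coef p bnf j s\<bar> \<and>
              \<bar>coef p bnf j r - coef p bnf j s\<bar> < \<delta> \<and>
              coef p bf j r \<in> {min (coef p bnf j r) (coef p bnf j s) ..
                               max (coef p bnf j r) (coef p bnf j s)} \<longrightarrow>
              ?M bf < ?M bnf))"
  proof (intro ballI allI impI)
    fix j r s and bf :: "real vec"
    assume j: "j \<in> {1..J}" and rs: "1 \<le> r \<and> r < s \<and> s \<le> p j"
      and bf: "bf \<in> carrier_vec (?N + 1)" and eq: "coef p bf j r = coef p bf j s"
    have P: "(j, s, r) \<in> level_pairs J p"
      using j rs by (simp add: level_pairs_def)
    have gap: "0 < lam0 * w j r s"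
      using lam0 assms(7)[OF j] rs by simp
    \<comment> \<open>Near \<open>bf\<close>, the drop of the continuous part stays below what fusing the pair saves.\<close>
    have "eventually (\<lambda>z. ?S bf - lam0 * w j r s < ?S (vec (?N + 1) z)) (nhds (($) bf))"
      using order_tendstoD(1)[OF cont[where x = "($) bf"]] gap repr[OF bf] by simp
    then have "eventually (\<lambda>z. ?S bf - lam0 * w j r s < ?S (vec (?N + 1) z) \<and>
        (\<forall>(j, s, r)\<in>level_pairs J p. l0 (coef p bf j r - coef p bf j s)
          \<le> l0 (coef p (vec (?N + 1) z) j r - coef p (vec (?N + 1) z) j s))) (nhds (($) bf))"
      using eventually_l0_pairs_le[of J p "($) bf", folded repr[OF bf]] by (rule eventually_conj)
    from eventually_nhds_fun_imp_box[OF this] obtain \<delta> where \<delta>: "\<delta> > 0" and near: "\<And>z. (\<And>i. \<bar>z i - bf $ i\<bar> < \<delta>) \<Longrightarrow>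
        ?S bf - lam0 * w j r s < ?S (vec (?N + 1) z) \<and>
        (\<forall>(j, s, r)\<in>level_pairs J p. l0 (coef p bf j r - coef p bf j s)
          \<le> l0 (coef p (vec (?N + 1) z) j r - coef p (vec (?N + 1) z) j s))"
      by (elim exE conjE) blast
    show "\<exists>\<delta>>0. \<forall>bnf \<in> carrier_vec (?N + 1).
              (\<forall>m < ?N + 1. m \<notin> {coord p j r, coord p j s} \<longrightarrow> bnf $ m = bf $ m) \<and>
              0 < \<bar>coef p bnf j r - coef p bnf j s\<bar> \<and>
              \<bar>coef p bnf j r - coef p bnf j s\<bar> < \<delta> \<and>
              coef p bf j r \<in> {min (coef p bnf j r) (coef p bnf j s) ..
                               max (coef p bnf j r) (coef p bnf j s)} \<longrightarrow>
              ?M bf < ?M bnf"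
    proof (intro exI[of _ \<delta>] conjI ballI impI \<delta>, elim conjE)
      fix b :: "real vec"
      assume b: "b \<in> carrier_vec (?N + 1)"
        and agree: "\<forall>m < ?N + 1. m \<notin> {coord p j r, coord p j s} \<longrightarrow> b $ m = bf $ m"
        and ne: "0 < \<bar>coef p b j r - coef p b j s\<bar>"
        and lt: "\<bar>coef p b j r - coef p b j s\<bar> < \<delta>"
        and mem: "coef p bf j r \<in> {min (coef p b j r) (coef p b j s) ..
                               max (coef p b j r) (coef p b j s)}"
      \<comment> \<open>Beyond the length of the vectors, \<open>z\<close> copies \<open>bf\<close>, so that it is close to \<open>bf\<close> at every
        index.\<close>
      define z where "z i = (if i < ?N + 1 then b $ i else bf $ i)" for i
      have z: "vec (?N + 1) z = b"
        using b by (auto simp: z_def)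
      have "\<bar>coef p b j r - coef p bf j r\<bar> < \<delta>" "\<bar>coef p b j s - coef p bf j s\<bar> < \<delta>"
        using mem lt eq by auto
      then have "\<bar>b $ coord p j r - bf $ coord p j r\<bar> < \<delta>" "\<bar>b $ coord p j s - bf $ coord p j s\<bar> < \<delta>"
        using rs by (auto simp: coef_def)
      then have "\<bar>z i - bf $ i\<bar> < \<delta>" for i
        using agree \<delta> by (cases "i \<in> {coord p j r, coord p j s}") (auto simp: z_def)
      note nz = near[of z, OF this, unfolded z]
      have "fusion_part J p w bf + w j r s \<le> fusion_part J p w b"
        using nz ne eq by (intro fusion_part_gap w P) auto
      then have "lam0 * (fusion_part J p w bf + w j r s) \<le> lam0 * fusion_part J p w b"
        using lam0 by (intro mult_left_mono) auto
      then show "?M bf < ?M b"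
        using nz by (simp add: Mpen_eq algebra_simps)
    qed
  qed
qed

end
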